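(* Let $\mathfrak{g}$ and $\mathfrak{q}$ be two $\mathsf{Lie}$-isoclinic Leibniz algebras. Then $\mathsf{ID}_*^{\mathsf{Lie}}(\mathfrak{g})\cong\mathsf{ID}_*^{\mathsf{Lie}}(\mathfrak{q})$ as Lie algebras.
   Context: $\mathbb{K}$ is a fixed ground field with $\frac12\in\mathbb{K}$. A Leibniz algebra over $\mathbb{K}$ is a $\mathbb{K}$-vector space $\mathfrak{g}$ with a bilinear bracket satisfying $[x,[y,z]]=[[x,y],z]-[[x,z],y]$ for all $x,y,z$. Put $[x,y]_{lie}=[x,y]+[y,x]$. The $\mathsf{Lie}$-center is $Z_{\mathsf{Lie}}(\mathfrak{g})=\{z\in\mathfrak{g}\mid [g,z]_{lie}=0\ \text{for all } g\in\mathfrak{g}\}$, a two-sided ideal. $\gamma_2^{\mathsf{Lie}}(\mathfrak{g})=[\mathfrak{g},\mathfrak{g}]_{\mathsf{Lie}}$ is the two-sided ideal generated by all $[x,y]_{lie}$, $x,y\in\mathfrak{g}$. A $\mathsf{Lie}$-derivation of $\mathfrak{g}$ is a linear map $d:\mathfrak{g}\to\mathfrak{g}$ with $d([x,y]_{lie})=[d(x),y]_{lie}+[x,d(y)]_{lie}$ for all $x,y$; these form a Lie algebra $\mathsf{Der}^{\mathsf{Lie}}(\mathfrak{g})$ under the commutator. $\mathsf{ID}_*^{\mathsf{Lie}}(\mathfrak{g})$ is the Lie subalgebra of all $\mathsf{Lie}$-derivations $d$ with $d(\mathfrak{g})\subseteq\gamma_2^{\mathsf{Lie}}(\mathfrak{g})$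 and $d(Z_{\mathsf{Lie}}(\mathfrak{g}))=0$. Leibniz algebras $\mathfrak{g}$ and $\mathfrak{q}$ are $\mathsf{Lie}$-isoclinic if there are Leibniz algebra isomorphisms $\eta:\mathfrak{g}/Z_{\mathsf{Lie}}(\mathfrak{g})\to\mathfrak{q}/Z_{\mathsf{Lie}}(\mathfrak{q})$ and $\xi:[\mathfrak{g},\mathfrak{g}]_{\mathsf{Lie}}\to[\mathfrak{q},\mathfrak{q}]_{\mathsf{Lie}}$ such that $\xi([x_1,x_2]_{lie})=[y_1,y_2]_{lie}$ whenever $x_i\in\mathfrak{g}$, $y_i\in\mathfrak{q}$ satisfy $\eta(x_i+Z_{\mathsf{Lie}}(\mathfrak{g}))=y_i+Z_{\mathsf{Lie}}(\mathfrak{q})$, $i=1,2$; $(\eta,\xi)$ is then called a $\mathsf{Lie}$-isoclinism. *)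

theory Defs
  imports "HOL-Algebra.Module" "HOL-Algebra.QuotRing"
begin

section \<open>Leibniz algebras and Lie algebras over a field\<close>

text \<open>
  The carrier, the vector space operations and the bracket are packed in the record type
  \<open>module\<close> of HOL-Algebra: its field \<open>mult\<close> holds the bracket, so \<open>x \<otimes>\<^bsub>L\<^esub> y\<close> is to be read
  as $[x,y]$. No associativity is assumed of it, and the field \<open>one\<close> is never used.
\<close>

locale bilinear_algebra = K?: field K + L?: module K L for K and L (structure) +
  assumes bracket_closed [simp, intro]:
      "\<lbrakk>x \<in> carrier L; y \<in> carrier L\<rbrakk> \<Longrightarrow> x \<otimes> y \<in> carrier L"
    and bracket_add_left:
      "\<lbrakk>x \<in> carrier L; y \<in> carrier L; z \<in> carrier L\<rbrakk> \<Longrightarrow> (x \<oplus> y) \<otimes> z = x \<otimes> z \<oplus> y \<otimes> z"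
    and bracket_add_right:
      "\<lbrakk>x \<in> carrier L; y \<in> carrier L; z \<in> carrier L\<rbrakk> \<Longrightarrow> x \<otimes> (y \<oplus> z) = x \<otimes> y \<oplus> x \<otimes> z"
    and bracket_smult_left:
      "\<lbrakk>a \<in> carrier K; x \<in> carrier L; y \<in> carrier L\<rbrakk> \<Longrightarrow> (a \<odot> x) \<otimes> y = a \<odot> (x \<otimes> y)"
    and bracket_smult_right:
      "\<lbrakk>a \<in> carrier K; x \<in> carrier L; y \<in> carrier L\<rbrakk> \<Longrightarrow> x \<otimes> (a \<odot> y) = a \<odot> (x \<otimes> y)"

locale leibniz_algebra = bilinear_algebra +
  assumes leibniz_identity:
      "\<lbrakk>x \<in> carrier L; y \<in> carrier L; z \<in> carrier L\<rbrakk> \<Longrightarrow>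
        x \<otimes> (y \<otimes> z) = (x \<otimes> y) \<otimes> z \<ominus> (x \<otimes> z) \<otimes> y"

locale lie_algebra = bilinear_algebra +
  assumes alternating: "x \<in> carrier L \<Longrightarrow> x \<otimes> x = \<zero>"
    and jacobi:
      "\<lbrakk>x \<in> carrier L; y \<in> carrier L; z \<in> carrier L\<rbrakk> \<Longrightarrow>
        x \<otimes> (y \<otimes> z) \<oplus> y \<otimes> (z \<otimes> x) \<oplus> z \<otimes> (x \<otimes> y) = \<zero>"

definition linear_maps ::
    "('k, 'r) ring_scheme \<Rightarrow> ('k, 'a, 'm) module_scheme \<Rightarrow> ('k, 'b, 'n) module_scheme \<Rightarrow> ('a \<Rightarrow> 'b) set"
  where "linear_maps K L M = {f \<in> carrier L \<rightarrow> carrier M.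
    (\<forall>x\<in>carrier L. \<forall>y\<in>carrier L. f (x \<oplus>\<^bsub>L\<^esub> y) = f x \<oplus>\<^bsub>M\<^esub> f y) \<and>
    (\<forall>a\<in>carrier K. \<forall>x\<in>carrier L. f (a \<odot>\<^bsub>L\<^esub> x) = a \<odot>\<^bsub>M\<^esub> f x)}"

text \<open>Isomorphisms of Leibniz algebras and of Lie algebras are both given by \<open>algebra_iso\<close>.\<close>

definition algebra_iso ::
    "('k, 'r) ring_scheme \<Rightarrow> ('k, 'a, 'm) module_scheme \<Rightarrow> ('k, 'b, 'n) module_scheme \<Rightarrow> ('a \<Rightarrow> 'b) set"
  where "algebra_iso K L M = {f \<in> linear_maps K L M.
    bij_betw f (carrier L) (carrier M) \<and>
    (\<forall>x\<in>carrier L. \<forall>y\<in>carrier L. f (x \<otimes>\<^bsub>L\<^esub> y) = f x \<otimes>\<^bsub>M\<^esub> f y)}"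

definition two_sided_ideal :: "('k, 'r) ring_scheme \<Rightarrow> ('k, 'a, 'm) module_scheme \<Rightarrow> 'a set \<Rightarrow> bool"
  where "two_sided_ideal K L I \<longleftrightarrow> submodule I K L \<and>
    (\<forall>x\<in>carrier L. \<forall>i\<in>I. x \<otimes>\<^bsub>L\<^esub> i \<in> I \<and> i \<otimes>\<^bsub>L\<^esub> x \<in> I)"

definition quotient_algebra ::
    "('k, 'a, 'm) module_scheme \<Rightarrow> 'a set \<Rightarrow> ('k, 'a set) module"
  where "quotient_algebra L I =
    \<lparr>carrier = a_rcosets\<^bsub>L\<^esub> I, mult = rcoset_mult L I, one = undefined,
     zero = I, add = set_add L, smult = (\<lambda>a X. \<Union>x\<in>X. I +>\<^bsub>L\<^esub> (a \<odot>\<^bsub>L\<^esub> x))\<rparr>"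


section \<open>Notions relative to Lie algebras\<close>

definition lie_sym :: "('k, 'a, 'm) module_scheme \<Rightarrow> 'a \<Rightarrow> 'a \<Rightarrow> 'a"
    \<comment> \<open>$[x,y]_{lie}$, the symmetrised bracket\<close>
  where "lie_sym L x y = (x \<otimes>\<^bsub>L\<^esub> y) \<oplus>\<^bsub>L\<^esub> (y \<otimes>\<^bsub>L\<^esub> x)"

definition Lie_center :: "('k, 'a, 'm) module_scheme \<Rightarrow> 'a set"
  where "Lie_center L = {z \<in> carrier L. \<forall>g\<in>carrier L. lie_sym L g z = \<zero>\<^bsub>L\<^esub>}"

definition Lie_gamma2 :: "('k, 'r) ring_scheme \<Rightarrow> ('k, 'a, 'm) module_scheme \<Rightarrow> 'a set"
  where "Lie_gamma2 K L =
    \<Inter>{I. two_sided_ideal K L I \<and> (\<forall>x\<in>carrier L. \<forall>y\<in>carrier L. lie_sym L x y \<in> I)}"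

text \<open>
  Derivations are extensional functions (value \<open>undefined\<close> outside the carrier), so that
  equality of derivations is equality as maps on the carrier.
\<close>

definition Lie_derivations ::
    "('k, 'r) ring_scheme \<Rightarrow> ('k, 'a, 'm) module_scheme \<Rightarrow> ('a \<Rightarrow> 'a) set"
  where "Lie_derivations K L = {d \<in> linear_maps K L L \<inter> extensional (carrier L).
    \<forall>x\<in>carrier L. \<forall>y\<in>carrier L. d (lie_sym L x y) = lie_sym L (d x) y \<oplus>\<^bsub>L\<^esub> lie_sym L x (d y)}"

definition Lie_Der ::
    "('k, 'r) ring_scheme \<Rightarrow> ('k, 'a, 'm) module_scheme \<Rightarrow> ('k, 'a \<Rightarrow> 'a) module"
  where "Lie_Der K L =
    \<lparr>carrier = Lie_derivations K L,
     mult = (\<lambda>d e. \<lambda>x\<in>carrier L. d (e x) \<ominus>\<^bsub>L\<^esub> e (d x)),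
     one = undefined,
     zero = (\<lambda>x\<in>carrier L. \<zero>\<^bsub>L\<^esub>),
     add = (\<lambda>d e. \<lambda>x\<in>carrier L. d x \<oplus>\<^bsub>L\<^esub> e x),
     smult = (\<lambda>a d. \<lambda>x\<in>carrier L. a \<odot>\<^bsub>L\<^esub> d x)\<rparr>"

definition Lie_ID ::
    "('k, 'r) ring_scheme \<Rightarrow> ('k, 'a, 'm) module_scheme \<Rightarrow> ('k, 'a \<Rightarrow> 'a) module"
    \<comment> \<open>$\mathsf{ID}_*^{\mathsf{Lie}}$\<close>
  where "Lie_ID K L = (Lie_Der K L)\<lparr>carrier :=
    {d \<in> Lie_derivations K L. d ` carrier L \<subseteq> Lie_gamma2 K L \<and> (\<forall>z\<in>Lie_center L. d z = \<zero>\<^bsub>L\<^esub>)}\<rparr>"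

definition Lie_isoclinism ::
    "('k, 'r) ring_scheme \<Rightarrow> ('k, 'a, 'm) module_scheme \<Rightarrow> ('k, 'b, 'n) module_scheme \<Rightarrow>
     ('a set \<Rightarrow> 'b set) \<Rightarrow> ('a \<Rightarrow> 'b) \<Rightarrow> bool"
  where "Lie_isoclinism K G Q \<eta> \<xi> \<longleftrightarrow>
    \<eta> \<in> algebra_iso K (quotient_algebra G (Lie_center G)) (quotient_algebra Q (Lie_center Q)) \<and>
    \<xi> \<in> algebra_iso K (G\<lparr>carrier := Lie_gamma2 K G\<rparr>) (Q\<lparr>carrier := Lie_gamma2 K Q\<rparr>) \<and>
    (\<forall>x1\<in>carrier G. \<forall>x2\<in>carrier G. \<forall>y1\<in>carrier Q. \<forall>y2\<in>carrier Q.
      \<eta> (Lie_center G +>\<^bsub>G\<^esub> x1) = Lie_center Q +>\<^bsub>Q\<^esub> y1 \<and>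
      \<eta> (Lie_center G +>\<^bsub>G\<^esub> x2) = Lie_center Q +>\<^bsub>Q\<^esub> y2 \<longrightarrow>
      \<xi> (lie_sym G x1 x2) = lie_sym Q y1 y2)"

definition Lie_isoclinic ::
    "('k, 'r) ring_scheme \<Rightarrow> ('k, 'a, 'm) module_scheme \<Rightarrow> ('k, 'b, 'n) module_scheme \<Rightarrow> bool"
  where "Lie_isoclinic K G Q \<longleftrightarrow> (\<exists>\<eta> \<xi>. Lie_isoclinism K G Q \<eta> \<xi>)"


section \<open>The objects above are algebras of the claimed kind\<close>

lemma (in leibniz_algebra) lie_sym_closed [simp, intro]:
  "\<lbrakk>x \<in> carrier L; y \<in> carrier L\<rbrakk> \<Longrightarrow> lie_sym L x y \<in> carrier L"
  by (simp add: lie_sym_def)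

lemma (in bilinear_algebra) bracket_zero:
  assumes x: "x \<in> carrier L"
  shows "\<zero> \<otimes> x = \<zero>" "x \<otimes> \<zero> = \<zero>"
  using bracket_smult_left[of "\<zero>\<^bsub>K\<^esub>" \<zero> x] bracket_smult_right[of "\<zero>\<^bsub>K\<^esub>" x \<zero>] x by simp_all

lemma (in bilinear_algebra) bracket_minus:
  assumes x: "x \<in> carrier L" and y: "y \<in> carrier L"
  shows "(\<ominus> x) \<otimes> y = \<ominus> (x \<otimes> y)" "x \<otimes> (\<ominus> y) = \<ominus> (x \<otimes> y)"
proof -
  have "(\<ominus> x) \<otimes> y \<oplus> x \<otimes> y = \<zero>"
    using bracket_add_left[of "\<ominus> x" x y] x y by (simp add: bracket_zero L.M.l_neg)
  then show "(\<ominus> x) \<otimes> y = \<ominus> (x \<otimes> y)" using x y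
    by (simp add: L.M.minus_equality)
  have "x \<otimes> (\<ominus> y) \<oplus> x \<otimes> y = \<zero>"
    using bracket_add_right[of x "\<ominus> y" y] x y by (simp add: bracket_zero L.M.l_neg)
  then show "x \<otimes> (\<ominus> y) = \<ominus> (x \<otimes> y)" using x y
    by (simp add: L.M.minus_equality)
qed

lemma (in leibniz_algebra) Lie_center_left:
  assumes z: "z \<in> Lie_center L" and x: "x \<in> carrier L"
  shows "x \<otimes> z = \<ominus> (z \<otimes> x)"
  using assms by (auto simp: Lie_center_def lie_sym_def intro: L.M.minus_equality[symmetric])

lemma (in leibniz_algebra) two_sided_ideal_Lie_center:
  "two_sided_ideal K L (Lie_center L)"
proof -
  have sub: "submodule (Lie_center L) K L"
  proof (rule submoduleI)
    show "Lie_center L \<subseteq> carrier L" by (auto simp: Lie_center_def)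
    show "\<zero> \<in> Lie_center L" by (auto simp: Lie_center_def lie_sym_def bracket_zero)
    fix a assume a: "a \<in> Lie_center L"
    then have ac: "a \<in> carrier L" by (simp add: Lie_center_def)
    have "lie_sym L g (\<ominus> a) = \<zero>" if g: "g \<in> carrier L" for g
      using g ac Lie_center_left[OF a g] by (simp add: lie_sym_def bracket_minus L.M.r_neg)
    then show "\<ominus> a \<in> Lie_center L" using ac by (simp add: Lie_center_def)
  next
    fix a b assume a: "a \<in> Lie_center L" and b: "b \<in> Lie_center L"
    then have c: "a \<in> carrier L" "b \<in> carrier L" by (simp_all add: Lie_center_def)
    have "lie_sym L g (a \<oplus> b) = \<zero>" if g: "g \<in> carrier L" for g
    proof -
      have "lie_sym L g (a \<oplus> b) = (g \<otimes> a \<oplus> a \<otimes> g) \<oplus> (g \<otimes> b \<oplus> b \<otimes> g)"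
        using g c by (simp add: lie_sym_def bracket_add_left bracket_add_right L.M.a_ac)
      also have "\<dots> = \<zero>" using g c a b by (simp add: Lie_center_def lie_sym_def)
      finally show ?thesis .
    qed
    then show "a \<oplus> b \<in> Lie_center L" using c by (simp add: Lie_center_def)
  next
    fix k a assume k: "k \<in> carrier K" and a: "a \<in> Lie_center L"
    then have c: "a \<in> carrier L" by (simp_all add: Lie_center_def)
    have "lie_sym L g (k \<odot> a) = \<zero>" if g: "g \<in> carrier L" for g
    proof -
      have "lie_sym L g (k \<odot> a) = k \<odot> (lie_sym L g a)"
        using g c k by (simp add: lie_sym_def bracket_smult_left bracket_smult_right smult_r_distr)
      also have "\<dots> = \<zero>" using g c a k by (simp add: Lie_center_def)
      finally show ?thesis .
    qed
    then show "k \<odot> a \<in> Lie_center L" using c k by (simp add: Lie_center_def)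
  qed
  have right: "z \<otimes> x \<in> Lie_center L" if z: "z \<in> Lie_center L" and x: "x \<in> carrier L" for z x
  proof -
    have zc: "z \<in> carrier L" using z by (simp add: Lie_center_def)
    have "lie_sym L a (z \<otimes> x) = \<zero>" if a: "a \<in> carrier L" for a
    proof -
      have az: "a \<otimes> z = \<ominus> (z \<otimes> a)" using Lie_center_left z a by blast
      have axz: "(a \<otimes> x) \<otimes> z = \<ominus> ((z \<otimes> a) \<otimes> x \<ominus> (z \<otimes> x) \<otimes> a)"
        using Lie_center_left[OF z, of "a \<otimes> x"] a x zc leibniz_identity[of z a x] by simp
      have "a \<otimes> (z \<otimes> x) = \<ominus> ((z \<otimes> a) \<otimes> x) \<ominus> \<ominus> ((z \<otimes> a) \<otimes> x \<ominus> (z \<otimes> x) \<otimes> a)"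
        using leibniz_identity[of a z x] a x zc by (simp add: az axz bracket_minus)
      also have "\<dots> = \<ominus> ((z \<otimes> x) \<otimes> a)"
        using a x zc by (simp add: a_minus_def L.M.minus_add L.M.r_neg1)
      finally show ?thesis using a x zc by (simp add: lie_sym_def L.M.l_neg)
    qed
    then show ?thesis using zc x by (simp add: Lie_center_def)
  qed
  have left: "x \<otimes> z \<in> Lie_center L" if z: "z \<in> Lie_center L" and x: "x \<in> carrier L" for z x
    using right[OF z x] Lie_center_left[OF z x] submoduleE(3)[OF sub] by metis
  show ?thesis using sub left right by (simp add: two_sided_ideal_def)
qed

lemma (in leibniz_algebra) leibniz_algebra_subalgebra:
  assumes I: "two_sided_ideal K L I"
  shows "leibniz_algebra K (L\<lparr>carrier := I\<rparr>)"
proof -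
  have s: "submodule I K L" using I by (simp add: two_sided_ideal_def)
  interpret S: module K "L\<lparr>carrier := I\<rparr>"
    by (rule submodule.submodule_is_module[OF s]) (rule module_axioms)
  have sub: "I \<subseteq> carrier L" using submoduleE(1)[OF s] .
  have m: "a_minus (L\<lparr>carrier := I\<rparr>) x y = x \<ominus> y" if "x \<in> I" "y \<in> I" for x y
  proof -
    have "\<ominus>\<^bsub>L\<lparr>carrier := I\<rparr>\<^esub> y = \<ominus> y"
    proof (rule L.M.minus_equality[symmetric])
      show "\<ominus>\<^bsub>L\<lparr>carrier := I\<rparr>\<^esub> y \<oplus> y = \<zero>" using S.M.l_neg[of y] that by simp
      show "\<ominus>\<^bsub>L\<lparr>carrier := I\<rparr>\<^esub> y \<in> carrier L" using S.M.a_inv_closed[of y] that sub by auto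
    qed (use that sub in auto)
    then show ?thesis by (simp add: a_minus_def)
  qed
  have cl: "x \<otimes> y \<in> I" if "x \<in> I" "y \<in> I" for x y using that I sub by (auto simp: two_sided_ideal_def)
  show ?thesis
    apply unfold_locales
    using sub cl
    by (auto simp: m subsetD bracket_add_left bracket_add_right bracket_smult_left bracket_smult_right
        leibniz_identity)
qed

lemma (in leibniz_algebra) two_sided_ideal_gamma2: "two_sided_ideal K L (Lie_gamma2 K L)"
proof -
  have c: "two_sided_ideal K L (carrier L) \<and> (\<forall>x\<in>carrier L. \<forall>y\<in>carrier L. lie_sym L x y \<in> carrier L)"
    using carrier_is_submodule by (simp add: two_sided_ideal_def)
  let ?F = "{I. two_sided_ideal K L I \<and> (\<forall>x\<in>carrier L. \<forall>y\<in>carrier L. lie_sym L x y \<in> I)}"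
  have s: "submodule I K L" if "I \<in> ?F" for I using that by (simp add: two_sided_ideal_def)
  have "submodule (\<Inter>?F) K L"
    apply (rule submoduleI)
    subgoal using c by blast
    subgoal using s by (metis (mono_tags, lifting) InterI submodule_def subgroup.one_closed monoid.select_convs(2))
    subgoal for a using s submoduleE(3) by (meson Inter_iff)
    subgoal for a b using s submoduleE(5) by (meson Inter_iff)
    subgoal for a b using s submoduleE(4) by (meson Inter_iff)
    done
  then show ?thesis unfolding two_sided_ideal_def Lie_gamma2_def
    by (auto simp: two_sided_ideal_def)
qed

lemma (in leibniz_algebra) leibniz_algebra_quotient:
  assumes I: "two_sided_ideal K L I"
  shows "leibniz_algebra K (quotient_algebra L I)"
proof -
  have s: "submodule I K L" using I by (simp add: two_sided_ideal_def)
  have sub: "I \<subseteq> carrier L" using submoduleE(1)[OF s] .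
  interpret A: abelian_subgroup I L
    by (rule abelian_subgroupI3)
      (use s in \<open>auto simp: additive_subgroup_def submodule_def L.M.abelian_group_axioms\<close>)
  let ?p = "\<lambda>x. I +> x"
  have eqd: "?p x' = ?p x" if "x' = i \<oplus> x" "i \<in> I" "x \<in> carrier L" for x' i x
    by (rule A.a_repr_independence'[symmetric]) (use that in \<open>auto simp: a_r_coset_def r_coset_def\<close>)
  have mem: "X \<in> ?p x \<longleftrightarrow> (\<exists>i\<in>I. X = i \<oplus> x)" for X x
    by (auto simp: a_r_coset_def r_coset_def)
  have self: "x \<in> ?p x" if "x \<in> carrier L" for x using A.a_rcos_self that by simp
  have Ic: "i \<otimes> x \<in> I" "x \<otimes> i \<in> I" if "i \<in> I" "x \<in> carrier L" for i x
    using I that by (auto simp: two_sided_ideal_def)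
  have Is: "k \<odot> i \<in> I" if "i \<in> I" "k \<in> carrier K" for i k using submoduleE(4)[OF s] that by auto
  have Ia: "i \<oplus> j \<in> I" if "i \<in> I" "j \<in> I" for i j using submoduleE(5)[OF s] that by auto
  have pm: "rcoset_mult L I (?p x) (?p y) = ?p (x \<otimes> y)" if x: "x \<in> carrier L" and y: "y \<in> carrier L" for x y
  proof -
    have "?p (x' \<otimes> y') = ?p (x \<otimes> y)" if x': "x' \<in> ?p x" and y': "y' \<in> ?p y" for x' y'
    proof -
      obtain i j where ij: "i \<in> I" "j \<in> I" "x' = i \<oplus> x" "y' = j \<oplus> y" using x' y' mem by auto
      then have c: "i \<in> carrier L" "j \<in> carrier L" using sub by auto
      have "x' \<otimes> y' = (i \<otimes> j \<oplus> i \<otimes> y \<oplus> x \<otimes> j) \<oplus> x \<otimes> y"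
        using c x y by (simp add: ij bracket_add_left bracket_add_right L.M.a_ac)
      then show ?thesis using eqd[of _ "i \<otimes> j \<oplus> i \<otimes> y \<oplus> x \<otimes> j" "x \<otimes> y"] ij c x y Ic Ia by auto
    qed
    then show ?thesis unfolding rcoset_mult_def using self x y by blast
  qed
  have ps: "(\<Union>x'\<in>?p x. ?p (k \<odot> x')) = ?p (k \<odot> x)" if k: "k \<in> carrier K" and x: "x \<in> carrier L" for k x
  proof -
    have "?p (k \<odot> x') = ?p (k \<odot> x)" if x': "x' \<in> ?p x" for x'
    proof -
      obtain i where i: "i \<in> I" "x' = i \<oplus> x" using x' mem by auto
      then show ?thesis using eqd[of "k \<odot> x'" "k \<odot> i" "k \<odot> x"] k x sub Is
        by (simp add: smult_r_distr subsetD)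
    qed
    then show ?thesis using self x by blast
  qed
  have pa: "set_add L (?p x) (?p y) = ?p (x \<oplus> y)" if "x \<in> carrier L" "y \<in> carrier L" for x y
    using A.a_rcos_sum that by simp
  have car: "carrier (quotient_algebra L I) = ?p ` carrier L"
    by (auto simp: quotient_algebra_def A_RCOSETS_def' a_r_coset_def')
  have z: "\<zero>\<^bsub>quotient_algebra L I\<^esub> = ?p \<zero>"
    using A.a_rcos_const[of \<zero>] s by (simp add: quotient_algebra_def A.a_subset sub L.M.a_coset_add_zero)
  note q = car z
  have ops: "?p x \<oplus>\<^bsub>quotient_algebra L I\<^esub> ?p y = ?p (x \<oplus> y)"
    "?p x \<otimes>\<^bsub>quotient_algebra L I\<^esub> ?p y = ?p (x \<otimes> y)"
     if "x \<in> carrier L" "y \<in> carrier L" for x y using that by (simp_all add: quotient_algebra_def pa pm)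
  have sop: "k \<odot>\<^bsub>quotient_algebra L I\<^esub> ?p x = ?p (k \<odot> x)"
     if "x \<in> carrier L" "k \<in> carrier K" for x k using that by (simp add: quotient_algebra_def ps)
  have ag: "abelian_group (quotient_algebra L I)"
  proof (rule abelian_groupI)
    show "\<exists>y\<in>carrier (quotient_algebra L I). y \<oplus>\<^bsub>quotient_algebra L I\<^esub> x = \<zero>\<^bsub>quotient_algebra L I\<^esub>"
      if "x \<in> carrier (quotient_algebra L I)" for x
      using that by (auto simp: q ops L.M.l_neg intro!: bexI[of _ "\<ominus> _"])
  qed (auto simp: q ops L.M.a_ac)
  interpret Q: module K "quotient_algebra L I"
    by (rule moduleI[OF K.is_cring ag])
      (auto simp: q ops sop smult_l_distr smult_r_distr smult_assoc1)
  have minus: "\<ominus>\<^bsub>quotient_algebra L I\<^esub> ?p y = ?p (\<ominus> y)" if "y \<in> carrier L" for y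
    by (rule Q.M.minus_equality) (use that in \<open>auto simp: q ops L.M.l_neg\<close>)
  show ?thesis
    by unfold_locales (auto simp: q ops sop bracket_add_left bracket_add_right bracket_smult_left
        bracket_smult_right leibniz_identity a_minus_def minus)
qed


lemma (in leibniz_algebra) lie_sym_add:
  "\<lbrakk>x \<in> carrier L; y \<in> carrier L; z \<in> carrier L\<rbrakk> \<Longrightarrow> lie_sym L (x \<oplus> y) z = lie_sym L x z \<oplus> lie_sym L y z"
  "\<lbrakk>x \<in> carrier L; y \<in> carrier L; z \<in> carrier L\<rbrakk> \<Longrightarrow> lie_sym L z (x \<oplus> y) = lie_sym L z x \<oplus> lie_sym L z y"
  by (simp_all add: lie_sym_def bracket_add_left bracket_add_right L.M.a_ac)

lemma (in leibniz_algebra) lie_sym_smult: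
  "\<lbrakk>a \<in> carrier K; x \<in> carrier L; z \<in> carrier L\<rbrakk> \<Longrightarrow> lie_sym L (a \<odot> x) z = a \<odot> lie_sym L x z"
  "\<lbrakk>a \<in> carrier K; x \<in> carrier L; z \<in> carrier L\<rbrakk> \<Longrightarrow> lie_sym L z (a \<odot> x) = a \<odot> lie_sym L z x"
  by (simp_all add: lie_sym_def bracket_smult_left bracket_smult_right smult_r_distr)

lemma (in leibniz_algebra) lie_sym_minus:
  "\<lbrakk>x \<in> carrier L; z \<in> carrier L\<rbrakk> \<Longrightarrow> lie_sym L (\<ominus> x) z = \<ominus> lie_sym L x z"
  "\<lbrakk>x \<in> carrier L; z \<in> carrier L\<rbrakk> \<Longrightarrow> lie_sym L z (\<ominus> x) = \<ominus> lie_sym L z x"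
  by (simp_all add: lie_sym_def bracket_minus L.M.minus_add)

lemma (in leibniz_algebra) Lie_derivationsD:
  assumes "d \<in> Lie_derivations K L"
  shows "x \<in> carrier L \<Longrightarrow> d x \<in> carrier L"
    and "\<lbrakk>x \<in> carrier L; y \<in> carrier L\<rbrakk> \<Longrightarrow> d (x \<oplus> y) = d x \<oplus> d y"
    and "\<lbrakk>a \<in> carrier K; x \<in> carrier L\<rbrakk> \<Longrightarrow> d (a \<odot> x) = a \<odot> d x"
    and "\<lbrakk>x \<in> carrier L; y \<in> carrier L\<rbrakk> \<Longrightarrow> d (lie_sym L x y) = lie_sym L (d x) y \<oplus> lie_sym L x (d y)"
    and "d \<in> extensional (carrier L)"
    and "d \<zero> = \<zero>"
    and "x \<in> carrier L \<Longrightarrow> d (\<ominus> x) = \<ominus> d x"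
proof -
  show 1: "x \<in> carrier L \<Longrightarrow> d x \<in> carrier L" for x
    using assms by (auto simp: Lie_derivations_def linear_maps_def)
  show 2: "\<lbrakk>x \<in> carrier L; y \<in> carrier L\<rbrakk> \<Longrightarrow> d (x \<oplus> y) = d x \<oplus> d y" for x y
    using assms by (auto simp: Lie_derivations_def linear_maps_def)
  show 3: "\<lbrakk>a \<in> carrier K; x \<in> carrier L\<rbrakk> \<Longrightarrow> d (a \<odot> x) = a \<odot> d x" for a x
    using assms by (auto simp: Lie_derivations_def linear_maps_def)
  show "\<lbrakk>x \<in> carrier L; y \<in> carrier L\<rbrakk> \<Longrightarrow> d (lie_sym L x y) = lie_sym L (d x) y \<oplus> lie_sym L x (d y)" for x y
    using assms by (auto simp: Lie_derivations_def)
  show "d \<in> extensional (carrier L)" using assms by (auto simp: Lie_derivations_def)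
  show 4: "d \<zero> = \<zero>" using 3[of "\<zero>\<^bsub>K\<^esub>" \<zero>] 1 by simp
  show "x \<in> carrier L \<Longrightarrow> d (\<ominus> x) = \<ominus> d x" for x
    using 2[of "\<ominus> x" x] 1 4 by (simp add: L.M.l_neg L.M.minus_equality)
qed

lemma Lie_Der_simps:
  "carrier (Lie_Der K L) = Lie_derivations K L"
  "d \<otimes>\<^bsub>Lie_Der K L\<^esub> e = (\<lambda>x\<in>carrier L. d (e x) \<ominus>\<^bsub>L\<^esub> e (d x))"
  "\<zero>\<^bsub>Lie_Der K L\<^esub> = (\<lambda>x\<in>carrier L. \<zero>\<^bsub>L\<^esub>)"
  "d \<oplus>\<^bsub>Lie_Der K L\<^esub> e = (\<lambda>x\<in>carrier L. d x \<oplus>\<^bsub>L\<^esub> e x)"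
  "a \<odot>\<^bsub>Lie_Der K L\<^esub> d = (\<lambda>x\<in>carrier L. a \<odot>\<^bsub>L\<^esub> d x)"
  by (simp_all add: Lie_Der_def)

lemma (in leibniz_algebra) Lie_derivationsI:
  assumes "\<And>x. x \<in> carrier L \<Longrightarrow> f x \<in> carrier L"
    and "\<And>x y. \<lbrakk>x \<in> carrier L; y \<in> carrier L\<rbrakk> \<Longrightarrow> f (x \<oplus> y) = f x \<oplus> f y"
    and "\<And>a x. \<lbrakk>a \<in> carrier K; x \<in> carrier L\<rbrakk> \<Longrightarrow> f (a \<odot> x) = a \<odot> f x"
    and "\<And>x y. \<lbrakk>x \<in> carrier L; y \<in> carrier L\<rbrakk> \<Longrightarrow> f (lie_sym L x y) = lie_sym L (f x) y \<oplus> lie_sym L x (f y)"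
  shows "(\<lambda>x\<in>carrier L. f x) \<in> Lie_derivations K L"
  using assms by (auto simp: Lie_derivations_def linear_maps_def)

lemma (in leibniz_algebra) smult_comm:
  "\<lbrakk>a \<in> carrier K; b \<in> carrier K; x \<in> carrier L\<rbrakk> \<Longrightarrow> a \<odot> (b \<odot> x) = b \<odot> (a \<odot> x)"
  by (metis K.m_comm smult_assoc1)

lemma (in leibniz_algebra) lie_algebra_Lie_Der: "lie_algebra K (Lie_Der K L)"
proof -
  note D = Lie_derivationsD
  have cz: "(\<lambda>x\<in>carrier L. \<zero>) \<in> Lie_derivations K L"
    by (rule Lie_derivationsI) (auto simp: lie_sym_def bracket_zero)
  have ca: "(\<lambda>x\<in>carrier L. d x \<oplus> e x) \<in> Lie_derivations K L"
    if d: "d \<in> Lie_derivations K L" and e: "e \<in> Lie_derivations K L" for d e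
    by (rule Lie_derivationsI)
      (auto simp: D[OF d] D[OF e] smult_r_distr L.M.a_ac lie_sym_add)
  have cs: "(\<lambda>x\<in>carrier L. a \<odot> d x) \<in> Lie_derivations K L"
    if d: "d \<in> Lie_derivations K L" and a: "a \<in> carrier K" for d a
    by (rule Lie_derivationsI)
      (use a in \<open>auto simp: D[OF d] smult_r_distr smult_comm lie_sym_smult\<close>)
  have cb: "(\<lambda>x\<in>carrier L. d (e x) \<ominus> e (d x)) \<in> Lie_derivations K L"
    if d: "d \<in> Lie_derivations K L" and e: "e \<in> Lie_derivations K L" for d e
  proof (rule Lie_derivationsI)
    fix x y assume x: "x \<in> carrier L" and y: "y \<in> carrier L"
    note DD = D[OF d] D[OF e]
    have cancel: "(p \<oplus> a) \<oplus> (b \<oplus> q) \<oplus> \<ominus> ((r \<oplus> b) \<oplus> (a \<oplus> s)) = (p \<oplus> \<ominus> r) \<oplus> (q \<oplus> \<ominus> s)"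
      if "p \<in> carrier L" "q \<in> carrier L" "r \<in> carrier L" "s \<in> carrier L" "a \<in> carrier L" "b \<in> carrier L"
      for p q r s a b
    proof -
      have "(p \<oplus> a) \<oplus> (b \<oplus> q) \<oplus> \<ominus> ((r \<oplus> b) \<oplus> (a \<oplus> s))
          = (a \<oplus> \<ominus> a) \<oplus> (b \<oplus> \<ominus> b) \<oplus> ((p \<oplus> \<ominus> r) \<oplus> (q \<oplus> \<ominus> s))"
        using that by (simp add: L.M.minus_add L.M.a_ac del: L.M.r_neg L.M.l_neg)
      then show ?thesis using that by (simp add: L.M.r_neg)
    qed
    have "d (e (lie_sym L x y)) \<ominus> e (d (lie_sym L x y)) =
      ((lie_sym L (d (e x)) y \<oplus> lie_sym L (e x) (d y)) \<oplus> (lie_sym L (d x) (e y) \<oplus> lie_sym L x (d (e y))))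
      \<oplus> \<ominus> ((lie_sym L (e (d x)) y \<oplus> lie_sym L (d x) (e y)) \<oplus> (lie_sym L (e x) (d y) \<oplus> lie_sym L x (e (d y))))"
      using x y by (simp add: a_minus_def DD)
    also have "\<dots> = (lie_sym L (d (e x)) y \<oplus> \<ominus> lie_sym L (e (d x)) y)
        \<oplus> (lie_sym L x (d (e y)) \<oplus> \<ominus> lie_sym L x (e (d y)))"
      by (rule cancel) (use x y in \<open>auto simp: DD\<close>)
    finally show "d (e (lie_sym L x y)) \<ominus> e (d (lie_sym L x y)) =
      lie_sym L (d (e x) \<ominus> e (d x)) y \<oplus> lie_sym L x (d (e y) \<ominus> e (d y))"
      using x y by (simp add: a_minus_def DD lie_sym_add lie_sym_minus)
  qed (auto simp: a_minus_def D[OF d] D[OF e] smult_r_distr smult_r_minus L.M.a_ac L.M.minus_add)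
  have ext: "d = e" if "d \<in> Lie_derivations K L" "e \<in> Lie_derivations K L"
     "\<And>x. x \<in> carrier L \<Longrightarrow> d x = e x" for d e
    using that D(5) by (meson extensionalityI)
  have eqI: "(\<lambda>x\<in>carrier L. f x) = (\<lambda>x\<in>carrier L. g x)" if "\<And>x. x \<in> carrier L \<Longrightarrow> f x = g x" for f g
    using that by (rule restrict_ext)
  let ?D = "Lie_Der K L"
  note S = Lie_Der_simps
  have ag: "abelian_group ?D"
  proof (rule abelian_groupI)
    fix x assume x: "x \<in> carrier ?D"
    then have xd: "x \<in> Lie_derivations K L" by (simp add: S)
    show "\<zero>\<^bsub>?D\<^esub> \<oplus>\<^bsub>?D\<^esub> x = x"
      unfolding S by (rule ext[OF ca[OF cz xd] xd]) (auto simp: D[OF xd])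
    have n: "(\<lambda>y\<in>carrier L. (\<ominus>\<^bsub>K\<^esub> \<one>\<^bsub>K\<^esub>) \<odot> x y) \<in> Lie_derivations K L" by (rule cs[OF xd]) simp
    show "\<exists>y\<in>carrier ?D. y \<oplus>\<^bsub>?D\<^esub> x = \<zero>\<^bsub>?D\<^esub>"
      apply (rule bexI[of _ "\<lambda>y\<in>carrier L. (\<ominus>\<^bsub>K\<^esub> \<one>\<^bsub>K\<^esub>) \<odot> x y"])
      using n by (auto simp: S D[OF xd] smult_l_minus L.M.l_neg intro!: eqI)
  next
    fix x y z assume "x \<in> carrier ?D" "y \<in> carrier ?D" "z \<in> carrier ?D"
    then have d: "x \<in> Lie_derivations K L" "y \<in> Lie_derivations K L" "z \<in> Lie_derivations K L" by (simp_all add: S)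
    show "x \<oplus>\<^bsub>?D\<^esub> y \<oplus>\<^bsub>?D\<^esub> z = x \<oplus>\<^bsub>?D\<^esub> (y \<oplus>\<^bsub>?D\<^esub> z)"
      by (auto simp: S D[OF d(1)] D[OF d(2)] D[OF d(3)] L.M.a_ac intro!: eqI)
  next
    fix x y assume "x \<in> carrier ?D" "y \<in> carrier ?D"
    then have d: "x \<in> Lie_derivations K L" "y \<in> Lie_derivations K L" by (simp_all add: S)
    show "x \<oplus>\<^bsub>?D\<^esub> y \<in> carrier ?D" using d by (simp add: S ca)
    show "x \<oplus>\<^bsub>?D\<^esub> y = y \<oplus>\<^bsub>?D\<^esub> x"
      by (auto simp: S D[OF d(1)] D[OF d(2)] L.M.a_ac intro!: eqI)
  qed (simp add: S cz)
  interpret Q: module K ?D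
  proof (rule moduleI[OF K.is_cring ag])
    show "\<one>\<^bsub>K\<^esub> \<odot>\<^bsub>?D\<^esub> x = x" if "x \<in> carrier ?D" for x
      using that unfolding S by (intro ext[OF cs]) (auto simp: D)
  qed (auto simp: S cs D smult_l_distr smult_r_distr smult_assoc1 intro!: eqI)
  have cancel4: "(p \<oplus> q) \<ominus> (r \<oplus> s) = (p \<ominus> r) \<oplus> (q \<ominus> s)"
    if "p \<in> carrier L" "q \<in> carrier L" "r \<in> carrier L" "s \<in> carrier L" for p q r s
    using that by (simp add: a_minus_def L.M.minus_add L.M.a_ac)
  have smult_diff: "k \<odot> p \<ominus> k \<odot> q = k \<odot> (p \<ominus> q)"
    if "k \<in> carrier K" "p \<in> carrier L" "q \<in> carrier L" for k p q
    using that by (simp add: a_minus_def smult_r_distr smult_r_minus)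
  have cancel6: "((a \<ominus> b) \<ominus> (c \<ominus> d)) \<oplus> (((c \<ominus> e) \<ominus> (f \<ominus> b)) \<oplus> ((f \<ominus> d) \<ominus> (a \<ominus> e))) = \<zero>"
    if "a \<in> carrier L" "b \<in> carrier L" "c \<in> carrier L" "d \<in> carrier L" "e \<in> carrier L" "f \<in> carrier L"
    for a b c d e f
  proof -
    have "((a \<ominus> b) \<ominus> (c \<ominus> d)) \<oplus> (((c \<ominus> e) \<ominus> (f \<ominus> b)) \<oplus> ((f \<ominus> d) \<ominus> (a \<ominus> e)))
        = (a \<oplus> \<ominus> a) \<oplus> ((b \<oplus> \<ominus> b) \<oplus> ((c \<oplus> \<ominus> c) \<oplus> ((d \<oplus> \<ominus> d) \<oplus> ((e \<oplus> \<ominus> e) \<oplus> (f \<oplus> \<ominus> f)))))"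
      using that by (simp add: a_minus_def L.M.minus_add L.M.a_ac del: L.M.r_neg L.M.l_neg)
    then show ?thesis using that by (simp add: L.M.r_neg)
  qed
  have Dd: "d (x \<ominus> y) = d x \<ominus> d y" if "d \<in> Lie_derivations K L" "x \<in> carrier L" "y \<in> carrier L" for d x y
    using that by (simp add: a_minus_def D)
  show ?thesis
  proof (intro lie_algebra.intro bilinear_algebra.intro bilinear_algebra_axioms.intro
      lie_algebra_axioms.intro)
    show "field K" by (rule K.field_axioms)
    show "module K ?D" by (rule Q.module_axioms)
  next
    fix x y assume "x \<in> carrier ?D" "y \<in> carrier ?D"
    then have x: "x \<in> Lie_derivations K L" and y: "y \<in> Lie_derivations K L" by (simp_all add: S)
    show "x \<otimes>\<^bsub>?D\<^esub> y \<in> carrier ?D" unfolding S by (rule cb[OF x y])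
    fix z assume "z \<in> carrier ?D"
    then have z: "z \<in> Lie_derivations K L" by (simp add: S)
    show "(x \<oplus>\<^bsub>?D\<^esub> y) \<otimes>\<^bsub>?D\<^esub> z = x \<otimes>\<^bsub>?D\<^esub> z \<oplus>\<^bsub>?D\<^esub> y \<otimes>\<^bsub>?D\<^esub> z"
      unfolding S by (rule eqI) (simp add: D[OF x] D[OF y] D[OF z] cancel4)
    show "x \<otimes>\<^bsub>?D\<^esub> (y \<oplus>\<^bsub>?D\<^esub> z) = x \<otimes>\<^bsub>?D\<^esub> y \<oplus>\<^bsub>?D\<^esub> x \<otimes>\<^bsub>?D\<^esub> z"
      unfolding S by (rule eqI) (simp add: D[OF x] D[OF y] D[OF z] cancel4)
    show "x \<otimes>\<^bsub>?D\<^esub> (y \<otimes>\<^bsub>?D\<^esub> z) \<oplus>\<^bsub>?D\<^esub> y \<otimes>\<^bsub>?D\<^esub> (z \<otimes>\<^bsub>?D\<^esub> x) \<oplus>\<^bsub>?D\<^esub> z \<otimes>\<^bsub>?D\<^esub> (x \<otimes>\<^bsub>?D\<^esub> y)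
        = \<zero>\<^bsub>?D\<^esub>"
      unfolding S by (rule eqI)
        (simp add: D(1)[OF x] D(1)[OF y] D(1)[OF z] Dd[OF x] Dd[OF y] Dd[OF z] L.M.a_assoc cancel6)
  next
    fix a x y assume a: "a \<in> carrier K" and "x \<in> carrier ?D" "y \<in> carrier ?D"
    then have x: "x \<in> Lie_derivations K L" and y: "y \<in> Lie_derivations K L" by (simp_all add: S)
    show "(a \<odot>\<^bsub>?D\<^esub> x) \<otimes>\<^bsub>?D\<^esub> y = a \<odot>\<^bsub>?D\<^esub> (x \<otimes>\<^bsub>?D\<^esub> y)"
      unfolding S by (rule eqI) (simp add: a D[OF x] D[OF y] smult_diff)
    show "x \<otimes>\<^bsub>?D\<^esub> (a \<odot>\<^bsub>?D\<^esub> y) = a \<odot>\<^bsub>?D\<^esub> (x \<otimes>\<^bsub>?D\<^esub> y)"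
      unfolding S by (rule eqI) (simp add: a D[OF x] D[OF y] smult_diff)
  next
    fix x assume "x \<in> carrier ?D"
    then have x: "x \<in> Lie_derivations K L" by (simp add: S)
    show "x \<otimes>\<^bsub>?D\<^esub> x = \<zero>\<^bsub>?D\<^esub>"
      unfolding S by (rule eqI) (simp add: D[OF x] a_minus_def L.M.r_neg)
  qed
qed

lemma (in lie_algebra) lie_algebra_subalgebra:
  assumes s: "submodule C K L" and cl: "\<And>x y. \<lbrakk>x \<in> C; y \<in> C\<rbrakk> \<Longrightarrow> x \<otimes> y \<in> C"
  shows "lie_algebra K (L\<lparr>carrier := C\<rparr>)"
proof -
  interpret S: module K "L\<lparr>carrier := C\<rparr>"
    by (rule submodule.submodule_is_module[OF s]) (rule module_axioms)
  have sub: "C \<subseteq> carrier L" using submoduleE(1)[OF s] .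
  show ?thesis
    by unfold_locales
      (use sub cl in \<open>auto simp: subsetD bracket_add_left bracket_add_right bracket_smult_left
        bracket_smult_right alternating jacobi\<close>)
qed

lemma (in leibniz_algebra) lie_algebra_Lie_ID: "lie_algebra K (Lie_ID K L)"
proof -
  interpret D: lie_algebra K "Lie_Der K L" by (rule lie_algebra_Lie_Der)
  let ?C = "{d \<in> Lie_derivations K L. d ` carrier L \<subseteq> Lie_gamma2 K L \<and> (\<forall>z\<in>Lie_center L. d z = \<zero>)}"
  have ID: "Lie_ID K L = (Lie_Der K L)\<lparr>carrier := ?C\<rparr>" by (simp add: Lie_ID_def)
  have g: "submodule (Lie_gamma2 K L) K L" using two_sided_ideal_gamma2 by (simp add: two_sided_ideal_def)
  note G = submoduleE[OF g]
  have g0: "\<zero> \<in> Lie_gamma2 K L" using G(1,2,3,5) L.M.l_neg by (metis equals0I subsetD)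
  have Z: "z \<in> carrier L" if "z \<in> Lie_center L" for z using that by (simp add: Lie_center_def)
  note S = Lie_Der_simps
  have sm: "submodule ?C K (Lie_Der K L)"
  proof (rule D.submoduleI)
    show "?C \<subseteq> carrier (Lie_Der K L)" by (auto simp: S)
    show "\<zero>\<^bsub>Lie_Der K L\<^esub> \<in> ?C" using D.zero_closed g0 Z by (auto simp: S)
    fix a assume a: "a \<in> ?C"
    show *: "k \<odot>\<^bsub>Lie_Der K L\<^esub> a \<in> ?C" if "k \<in> carrier K" for k
      using D.smult_closed[of k a] that a G(4) Z by (auto simp: S)
    have "\<ominus>\<^bsub>Lie_Der K L\<^esub> a = (\<ominus>\<^bsub>K\<^esub> \<one>\<^bsub>K\<^esub>) \<odot>\<^bsub>Lie_Der K L\<^esub> a"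
      using a D.smult_l_minus[of "\<one>\<^bsub>K\<^esub>" a] by (simp add: S(1) D.smult_one)
    then show "\<ominus>\<^bsub>Lie_Der K L\<^esub> a \<in> ?C" using *[of "\<ominus>\<^bsub>K\<^esub> \<one>\<^bsub>K\<^esub>"] by (metis K.a_inv_closed K.one_closed)
    fix b assume b: "b \<in> ?C"
    show "a \<oplus>\<^bsub>Lie_Der K L\<^esub> b \<in> ?C"
      using D.M.add.m_closed[of a b] a b G(5) Z by (auto simp: S image_subset_iff)
  qed
  have cb: "a \<otimes>\<^bsub>Lie_Der K L\<^esub> b \<in> ?C" if a: "a \<in> ?C" and b: "b \<in> ?C" for a b
  proof -
    have ad: "a \<in> Lie_derivations K L" and bd: "b \<in> Lie_derivations K L" using a b by simp_all
    have "a (b x) \<ominus> b (a x) \<in> Lie_gamma2 K L" if "x \<in> carrier L" for x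
      unfolding a_minus_def using that a b Lie_derivationsD(1)[OF ad] Lie_derivationsD(1)[OF bd]
      by (intro G(5) G(3)) auto
    moreover have "a (b z) \<ominus> b (a z) = \<zero>" if "z \<in> Lie_center L" for z
      using that a b by (simp add: Lie_derivationsD(6)[OF ad] Lie_derivationsD(6)[OF bd] a_minus_def)
    ultimately show ?thesis using D.bracket_closed[of a b] ad bd Z by (simp add: S image_subset_iff)
  qed
  show ?thesis unfolding ID by (rule D.lie_algebra_subalgebra[OF sm cb])
qed

end

theory Submission
  imports Defs
begin

text \<open>
  A derivation \<open>d\<close> in $\mathsf{ID}_*^{\mathsf{Lie}}(\mathfrak{g})$ kills the $\mathsf{Lie}$-center, so it
  factors through $\mathfrak{g}/Z_{\mathsf{Lie}}(\mathfrak{g})$, and it takes values in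
  $\gamma_2^{\mathsf{Lie}}(\mathfrak{g})$. Hence an isoclinism $(\eta,\xi)$ transports it to
  $y \mapsto \xi(d(x))$ for any $x$ with $\eta(x+Z)=y+Z$. This respects derivations and
  commutators because $\eta(c+Z)=\xi(c)+Z$ for $c\in\gamma_2^{\mathsf{Lie}}(\mathfrak{g})$: this is clear on the
  elements $[x_1,x_2]_{lie}$, and it propagates to the ideal that they generate since
  $[\mathfrak{g},\gamma_2^{\mathsf{Lie}}(\mathfrak{g})]=0$, so that $[c,y]=[c,y]_{lie}$.
  The inverse isoclinism transports back.
\<close>

section \<open>Quotient operations on representatives\<close>

text \<open>\<open>rcoset_mult\<close> is a union over all products of representatives. These fill
  no more than one coset: changing \<open>x\<close> by \<open>i\<close> and \<open>y\<close> by
  \<open>j\<close> changes the product by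
  \<open>i \<otimes> j \<oplus> i \<otimes> y \<oplus> x \<otimes> j\<close>, which lies in the
  ideal.\<close>

lemma (in leibniz_algebra) rcoset_mult_ideal:
  assumes I: "two_sided_ideal K L I" and x: "x \<in> carrier L" and y: "y \<in> carrier L"
  shows "rcoset_mult L I (I +> x) (I +> y) = I +> (x \<otimes> y)"
proof -
  have s: "submodule I K L" using I by (simp add: two_sided_ideal_def)
  note sub = submoduleE(1)[OF s]
  interpret A: abelian_subgroup I L
    by (rule abelian_subgroupI3)
      (use s in \<open>auto simp: additive_subgroup_def submodule_def L.M.abelian_group_axioms\<close>)
  have "I +> (x' \<otimes> y') = I +> (x \<otimes> y)" if x': "x' \<in> I +> x" and y': "y' \<in> I +> y" for x' y'
  proof -
    obtain i j where ij: "i \<in> I" "j \<in> I" "x' = i \<oplus> x" "y' = j \<oplus> y"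
      using x' y' by (auto simp: a_r_coset_def r_coset_def)
    then have c: "i \<in> carrier L" "j \<in> carrier L" using sub by auto
    have "i \<otimes> j \<oplus> i \<otimes> y \<oplus> x \<otimes> j \<in> I"
      using I ij c x y by (auto simp: two_sided_ideal_def intro!: submoduleE(5)[OF s])
    moreover have "x' \<otimes> y' = (i \<otimes> j \<oplus> i \<otimes> y \<oplus> x \<otimes> j) \<oplus> x \<otimes> y"
      using c x y by (simp add: ij bracket_add_left bracket_add_right L.M.a_ac)
    ultimately have "x' \<otimes> y' \<in> I +> (x \<otimes> y)" by (auto simp: a_r_coset_def r_coset_def)
    then show ?thesis using A.a_repr_independence'[of "x' \<otimes> y'" "x \<otimes> y"] x y by simp
  qed
  then show ?thesis
    unfolding rcoset_mult_def using A.a_rcos_self x y by blast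
qed

lemma (in leibniz_algebra) smult_rcoset:
  assumes s: "submodule I K L" and k: "k \<in> carrier K" and x: "x \<in> carrier L"
  shows "(\<Union>x'\<in>I +> x. I +> (k \<odot> x')) = I +> (k \<odot> x)"
proof -
  interpret A: abelian_subgroup I L
    by (rule abelian_subgroupI3)
      (use s in \<open>auto simp: additive_subgroup_def submodule_def L.M.abelian_group_axioms\<close>)
  have "I +> (k \<odot> x') = I +> (k \<odot> x)" if x': "x' \<in> I +> x" for x'
  proof -
    obtain i where i: "i \<in> I" "x' = i \<oplus> x"
      using x' by (auto simp: a_r_coset_def r_coset_def)
    then have "k \<odot> x' = k \<odot> i \<oplus> k \<odot> x"
      using k x submoduleE(1)[OF s] by (auto simp: smult_r_distr)
    then have "k \<odot> x' \<in> I +> (k \<odot> x)"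
      using submoduleE(4)[OF s k i(1)] by (auto simp: a_r_coset_def r_coset_def)
    then show ?thesis using A.a_repr_independence'[of "k \<odot> x'" "k \<odot> x"] k x by simp
  qed
  then show ?thesis using A.a_rcos_self x by blast
qed

text \<open>Reduces computations in the quotient to representatives, so that an isomorphism of
  quotients can be read as a relation between elements.\<close>

lemma (in leibniz_algebra) quotient_algebra_rcoset:
  assumes I: "two_sided_ideal K L I"
  shows "carrier (quotient_algebra L I) = (+>) I ` carrier L"
    and "\<lbrakk>x \<in> carrier L; y \<in> carrier L\<rbrakk> \<Longrightarrow>
      (I +> x) \<oplus>\<^bsub>quotient_algebra L I\<^esub> (I +> y) = I +> (x \<oplus> y)"
    and "\<lbrakk>x \<in> carrier L; y \<in> carrier L\<rbrakk> \<Longrightarrow>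
      (I +> x) \<otimes>\<^bsub>quotient_algebra L I\<^esub> (I +> y) = I +> (x \<otimes> y)"
    and "\<lbrakk>k \<in> carrier K; x \<in> carrier L\<rbrakk> \<Longrightarrow>
      k \<odot>\<^bsub>quotient_algebra L I\<^esub> (I +> x) = I +> (k \<odot> x)"
    and "\<zero>\<^bsub>quotient_algebra L I\<^esub> = I"
    and "x \<in> carrier L \<Longrightarrow> I +> x = I \<longleftrightarrow> x \<in> I"
proof -
  have s: "submodule I K L" using I by (simp add: two_sided_ideal_def)
  interpret A: abelian_subgroup I L
    by (rule abelian_subgroupI3)
      (use s in \<open>auto simp: additive_subgroup_def submodule_def L.M.abelian_group_axioms\<close>)
  show "carrier (quotient_algebra L I) = (+>) I ` carrier L"
    by (auto simp: quotient_algebra_def A_RCOSETS_def' a_r_coset_def')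
  show "(I +> x) \<oplus>\<^bsub>quotient_algebra L I\<^esub> (I +> y) = I +> (x \<oplus> y)"
    if "x \<in> carrier L" "y \<in> carrier L"
    using that by (simp add: quotient_algebra_def A.a_rcos_sum)
  show "(I +> x) \<otimes>\<^bsub>quotient_algebra L I\<^esub> (I +> y) = I +> (x \<otimes> y)"
    if "x \<in> carrier L" "y \<in> carrier L"
    using that by (simp add: quotient_algebra_def rcoset_mult_ideal[OF I])
  show "k \<odot>\<^bsub>quotient_algebra L I\<^esub> (I +> x) = I +> (k \<odot> x)"
    if "k \<in> carrier K" "x \<in> carrier L"
    using that by (simp add: quotient_algebra_def smult_rcoset[OF s])
  show "\<zero>\<^bsub>quotient_algebra L I\<^esub> = I" by (simp add: quotient_algebra_def)
  show "I +> x = I \<longleftrightarrow> x \<in> I" if "x \<in> carrier L"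
    using A.a_rcos_self[OF that] A.a_rcos_const by auto
qed

section \<open>The ideal generated by the symmetrised brackets\<close>

lemma Lie_center_closed: "z \<in> Lie_center L \<Longrightarrow> z \<in> carrier L"
  by (simp add: Lie_center_def)

lemma (in leibniz_algebra) submodule_Lie_gamma2: "submodule (Lie_gamma2 K L) K L"
  using two_sided_ideal_gamma2 by (simp add: two_sided_ideal_def)

lemma (in leibniz_algebra) lie_sym_in_gamma2:
  "\<lbrakk>x \<in> carrier L; y \<in> carrier L\<rbrakk> \<Longrightarrow> lie_sym L x y \<in> Lie_gamma2 K L"
  by (auto simp: Lie_gamma2_def)

text \<open>Serves as the induction principle for \<open>Lie_gamma2\<close>: a property holds
  throughout once the elements having it form an ideal that contains the generators.\<close>

lemma Lie_gamma2_least: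
  "\<lbrakk>two_sided_ideal K L I; \<And>x y. \<lbrakk>x \<in> carrier L; y \<in> carrier L\<rbrakk> \<Longrightarrow> lie_sym L x y \<in> I\<rbrakk>
    \<Longrightarrow> Lie_gamma2 K L \<subseteq> I"
  by (auto simp: Lie_gamma2_def)

text \<open>By the Leibniz identity \<open>u \<otimes> (y \<otimes> z)\<close> is antisymmetric in
  \<open>y\<close> and \<open>z\<close>, so it cancels on symmetrised brackets; ideal induction does
  the rest.\<close>

lemma (in leibniz_algebra) bracket_gamma2_right:
  assumes c: "c \<in> Lie_gamma2 K L" and x: "x \<in> carrier L"
  shows "x \<otimes> c = \<zero>"
proof -
  let ?I = "{c \<in> carrier L. \<forall>x\<in>carrier L. x \<otimes> c = \<zero>}"
  have "submodule ?I K L"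
    by (rule submoduleI) (auto simp: bracket_zero bracket_minus bracket_add_right bracket_smult_right)
  \<comment> \<open>For \<open>c\<close> in \<open>?I\<close>, the products
    \<open>x \<otimes> c\<close> are zero, and the Leibniz identity turns
    \<open>u \<otimes> (c \<otimes> x)\<close> into a difference of
    \<open>(u \<otimes> c) \<otimes> x\<close> and \<open>(u \<otimes> x) \<otimes> c\<close>, which
    both vanish.\<close>
  then have "two_sided_ideal K L ?I"
    by (auto simp: two_sided_ideal_def bracket_zero leibniz_identity a_minus_def)
  moreover have "lie_sym L y z \<in> ?I" if "y \<in> carrier L" "z \<in> carrier L" for y z
  proof -
    have "u \<otimes> lie_sym L y z = \<zero>" if u: "u \<in> carrier L" for u
    proof -
      let ?p = "(u \<otimes> y) \<otimes> z" and ?q = "(u \<otimes> z) \<otimes> y"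
      have "u \<otimes> lie_sym L y z = (?p \<oplus> \<ominus> ?q) \<oplus> (?q \<oplus> \<ominus> ?p)"
        using \<open>y \<in> carrier L\<close> \<open>z \<in> carrier L\<close> u
        by (simp add: lie_sym_def bracket_add_right leibniz_identity a_minus_def)
      also have "\<dots> = (?p \<oplus> \<ominus> ?p) \<oplus> (?q \<oplus> \<ominus> ?q)"
        using \<open>y \<in> carrier L\<close> \<open>z \<in> carrier L\<close> u
        by (simp add: L.M.a_ac del: L.M.r_neg L.M.l_neg)
      also have "\<dots> = \<zero>"
        using \<open>y \<in> carrier L\<close> \<open>z \<in> carrier L\<close> u by (simp add: L.M.r_neg)
      finally show ?thesis .
    qed
    then show ?thesis using that by simp
  qed
  ultimately have "Lie_gamma2 K L \<subseteq> ?I" by (rule Lie_gamma2_least)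
  then show ?thesis using c x by blast
qed

lemma Lie_ID_simps:
  "carrier (Lie_ID K L) =
    {d \<in> Lie_derivations K L. d ` carrier L \<subseteq> Lie_gamma2 K L \<and> (\<forall>z\<in>Lie_center L. d z = \<zero>\<^bsub>L\<^esub>)}"
  "d \<otimes>\<^bsub>Lie_ID K L\<^esub> e = (\<lambda>x\<in>carrier L. d (e x) \<ominus>\<^bsub>L\<^esub> e (d x))"
  "d \<oplus>\<^bsub>Lie_ID K L\<^esub> e = (\<lambda>x\<in>carrier L. d x \<oplus>\<^bsub>L\<^esub> e x)"
  "a \<odot>\<^bsub>Lie_ID K L\<^esub> d = (\<lambda>x\<in>carrier L. a \<odot>\<^bsub>L\<^esub> d x)"
  by (simp_all add: Lie_ID_def Lie_Der_def)

section \<open>Isoclinism as a relation between elements\<close>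

text \<open>
  The relation \<open>R x y\<close> stands for $\eta(x+Z)=y+Z$. Expressed this way the data are symmetric in
  \<open>G\<close> and \<open>Q\<close>, and no representatives have to be chosen.
\<close>

locale Lie_isoclinism_relation =
  G: leibniz_algebra K G + Q: leibniz_algebra K Q
  for K :: "('k, 'r) ring_scheme" and G :: "('k, 'a, 'm) module_scheme"
    and Q :: "('k, 'b, 'n) module_scheme" +
  fixes R :: "'a \<Rightarrow> 'b \<Rightarrow> bool" and \<xi> :: "'a \<Rightarrow> 'b"
  assumes R_carrier: "R x y \<Longrightarrow> x \<in> carrier G \<and> y \<in> carrier Q"
    and R_left_total: "x \<in> carrier G \<Longrightarrow> \<exists>y. R x y"
    and R_right_total: "y \<in> carrier Q \<Longrightarrow> \<exists>x. R x y"
    and R_add: "\<lbrakk>R x y; R x' y'\<rbrakk> \<Longrightarrow> R (x \<oplus>\<^bsub>G\<^esub> x') (y \<oplus>\<^bsub>Q\<^esub> y')"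
    and R_smult: "\<lbrakk>a \<in> carrier K; R x y\<rbrakk> \<Longrightarrow> R (a \<odot>\<^bsub>G\<^esub> x) (a \<odot>\<^bsub>Q\<^esub> y)"
    and R_lie_sym: "\<lbrakk>R x y; R x' y'\<rbrakk> \<Longrightarrow> R (lie_sym G x x') (lie_sym Q y y')"
    and R_center: "R x y \<Longrightarrow> x \<in> Lie_center G \<longleftrightarrow> y \<in> Lie_center Q"
    and xi_bij: "bij_betw \<xi> (Lie_gamma2 K G) (Lie_gamma2 K Q)"
    and xi_add: "\<lbrakk>c \<in> Lie_gamma2 K G; c' \<in> Lie_gamma2 K G\<rbrakk> \<Longrightarrow> \<xi> (c \<oplus>\<^bsub>G\<^esub> c') = \<xi> c \<oplus>\<^bsub>Q\<^esub> \<xi> c'"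
    and xi_smult: "\<lbrakk>a \<in> carrier K; c \<in> Lie_gamma2 K G\<rbrakk> \<Longrightarrow> \<xi> (a \<odot>\<^bsub>G\<^esub> c) = a \<odot>\<^bsub>Q\<^esub> \<xi> c"
    and xi_lie_sym: "\<lbrakk>R x y; R x' y'\<rbrakk> \<Longrightarrow> \<xi> (lie_sym G x x') = lie_sym Q y y'"
begin

lemma R_minus: "R x y \<Longrightarrow> R (\<ominus>\<^bsub>G\<^esub> x) (\<ominus>\<^bsub>Q\<^esub> y)"
  using R_smult[of "\<ominus>\<^bsub>K\<^esub> \<one>\<^bsub>K\<^esub>" x y] R_carrier[of x y]
  by (simp add: G.smult_l_minus Q.smult_l_minus)

lemma R_zero: "R \<zero>\<^bsub>G\<^esub> \<zero>\<^bsub>Q\<^esub>"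
proof -
  obtain y where "R \<zero>\<^bsub>G\<^esub> y" using R_left_total[of "\<zero>\<^bsub>G\<^esub>"] by auto
  \<comment> \<open>Scaling any partner of zero by the zero of the field yields the pair of
    zeros.\<close>
  then show ?thesis using R_smult[of "\<zero>\<^bsub>K\<^esub>" "\<zero>\<^bsub>G\<^esub>" y] R_carrier[of "\<zero>\<^bsub>G\<^esub>" y] by simp
qed

lemma xi_closed: "c \<in> Lie_gamma2 K G \<Longrightarrow> \<xi> c \<in> Lie_gamma2 K Q"
  using xi_bij by (rule bij_betwE[THEN bspec])

lemma gamma2_closed:
  "c \<in> Lie_gamma2 K G \<Longrightarrow> c \<in> carrier G" "c' \<in> Lie_gamma2 K Q \<Longrightarrow> c' \<in> carrier Q"
  using G.submoduleE(1)[OF G.submodule_Lie_gamma2] Q.submoduleE(1)[OF Q.submodule_Lie_gamma2] by auto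

lemmas gamma2_smult = G.submoduleE(4)[OF G.submodule_Lie_gamma2]
lemmas gamma2_add = G.submoduleE(5)[OF G.submodule_Lie_gamma2]
lemmas gamma2_minus = G.submoduleE(3)[OF G.submodule_Lie_gamma2]

lemma gamma2_zero: "\<zero>\<^bsub>G\<^esub> \<in> Lie_gamma2 K G"
  using G.lie_sym_in_gamma2[of "\<zero>\<^bsub>G\<^esub>" "\<zero>\<^bsub>G\<^esub>"] by (simp add: lie_sym_def G.bracket_zero)

lemma xi_zero: "\<xi> \<zero>\<^bsub>G\<^esub> = \<zero>\<^bsub>Q\<^esub>"
  using xi_smult[of "\<zero>\<^bsub>K\<^esub>" "\<zero>\<^bsub>G\<^esub>"] gamma2_zero xi_closed[of "\<zero>\<^bsub>G\<^esub>"] by (simp add: gamma2_closed)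

lemma xi_minus: "c \<in> Lie_gamma2 K G \<Longrightarrow> \<xi> (\<ominus>\<^bsub>G\<^esub> c) = \<ominus>\<^bsub>Q\<^esub> \<xi> c"
  using xi_smult[of "\<ominus>\<^bsub>K\<^esub> \<one>\<^bsub>K\<^esub>" c] xi_closed[of c]
  by (simp add: G.smult_l_minus Q.smult_l_minus gamma2_closed)

text \<open>Links the two halves of an isoclinism: \<open>\<xi> c\<close> may serve as a partner of
  \<open>c\<close> wherever a related pair is required. The proof is an ideal induction over
  \<open>Lie_gamma2\<close>.\<close>

lemma R_xi:
  assumes "c \<in> Lie_gamma2 K G"
  shows "R c (\<xi> c)"
proof -
  let ?I = "{c \<in> Lie_gamma2 K G. R c (\<xi> c)}"
  have sym: "lie_sym G x y \<in> ?I" if x: "x \<in> carrier G" and y: "y \<in> carrier G" for x y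
  proof -
    obtain x' y' where "R x x'" "R y y'" using R_left_total x y by blast
    then show ?thesis using G.lie_sym_in_gamma2[OF x y] R_lie_sym[of x x' y y'] by (simp add: xi_lie_sym)
  qed
  have "submodule ?I K G"
    by (rule G.submoduleI)
      (auto simp: gamma2_closed gamma2_zero gamma2_minus gamma2_add gamma2_smult R_zero R_minus
        R_add R_smult xi_zero xi_minus xi_add xi_smult)
  moreover have "x \<otimes>\<^bsub>G\<^esub> i \<in> ?I \<and> i \<otimes>\<^bsub>G\<^esub> x \<in> ?I" if x: "x \<in> carrier G" and i: "i \<in> ?I" for x i
  proof -
    have ic: "i \<in> carrier G" and i0: "x \<otimes>\<^bsub>G\<^esub> i = \<zero>\<^bsub>G\<^esub>"
      using i x gamma2_closed G.bracket_gamma2_right by auto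
    \<comment> \<open>Since the opposite product vanishes, this product is itself a symmetrised
      bracket, hence covered by \<open>sym\<close>.\<close>
    then have "i \<otimes>\<^bsub>G\<^esub> x = lie_sym G i x" using x by (simp add: lie_sym_def)
    then show ?thesis using sym[OF ic x] i0 by (simp add: gamma2_zero xi_zero R_zero)
  qed
  ultimately have "two_sided_ideal K G ?I" by (simp add: two_sided_ideal_def)
  then have "Lie_gamma2 K G \<subseteq> ?I" using sym by (rule Lie_gamma2_least)
  then show ?thesis using assms by blast
qed

section \<open>Transport of derivations\<close>

text \<open>For \<open>d\<close> in \<open>Lie_ID\<close> the chosen partner of \<open>y\<close> is
  immaterial, by \<open>Lie_ID_cong\<close>. Restricting to the carrier gives the extensional form
  required of derivations.\<close>

definition transfer :: "('a \<Rightarrow> 'a) \<Rightarrow> 'b \<Rightarrow> 'b"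
  where "transfer d = (\<lambda>y\<in>carrier Q. \<xi> (d (SOME x. R x y)))"

lemma Lie_ID_D:
  assumes "d \<in> carrier (Lie_ID K G)"
  shows "d \<in> Lie_derivations K G"
    and "x \<in> carrier G \<Longrightarrow> d x \<in> Lie_gamma2 K G"
    and "z \<in> Lie_center G \<Longrightarrow> d z = \<zero>\<^bsub>G\<^esub>"
  using assms by (auto simp: Lie_ID_simps)

text \<open>Two partners of \<open>y\<close> differ by a partner of zero, which
  \<open>R_center\<close> places in the Lie-center, where \<open>d\<close> vanishes.\<close>

lemma Lie_ID_cong:
  assumes d: "d \<in> carrier (Lie_ID K G)" and R: "R x y" "R x' y"
  shows "d x = d x'"
proof -
  note D = G.Lie_derivationsD[OF Lie_ID_D(1)[OF d]]
  have c: "x \<in> carrier G" "x' \<in> carrier G" "y \<in> carrier Q" using R R_carrier by auto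
  have "R (x \<oplus>\<^bsub>G\<^esub> \<ominus>\<^bsub>G\<^esub> x') \<zero>\<^bsub>Q\<^esub>"
    using R_add[OF R(1) R_minus[OF R(2)]] c by (simp add: Q.M.r_neg)
  moreover have "\<zero>\<^bsub>Q\<^esub> \<in> Lie_center Q" by (simp add: Lie_center_def lie_sym_def Q.bracket_zero)
  ultimately have "d (x \<oplus>\<^bsub>G\<^esub> \<ominus>\<^bsub>G\<^esub> x') = \<zero>\<^bsub>G\<^esub>" using R_center Lie_ID_D(3)[OF d] by blast
  then have "d x \<oplus>\<^bsub>G\<^esub> \<ominus>\<^bsub>G\<^esub> d x' = \<zero>\<^bsub>G\<^esub>" using c by (simp add: D)
  then show ?thesis using c G.M.minus_equality[of "d x" "\<ominus>\<^bsub>G\<^esub> d x'"] by (simp add: D)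
qed

text \<open>Eliminates the choice operator: any convenient partner computes
  \<open>transfer d\<close>.\<close>

lemma transfer_eq:
  assumes d: "d \<in> carrier (Lie_ID K G)" and R: "R x y"
  shows "transfer d y = \<xi> (d x)"
proof -
  have "R (SOME x. R x y) y" using R by (rule someI)
  then have "d (SOME x. R x y) = d x" using Lie_ID_cong[OF d _ R] by blast
  then show ?thesis using R_carrier[OF R] by (simp add: transfer_def)
qed

lemma transfer_closed:
  assumes d: "d \<in> carrier (Lie_ID K G)"
  shows "transfer d \<in> carrier (Lie_ID K Q)"
proof -
  note D = G.Lie_derivationsD[OF Lie_ID_D(1)[OF d]] and g = Lie_ID_D(2)[OF d]
  note eq = transfer_eq[OF d]
  have tg: "transfer d y \<in> Lie_gamma2 K Q" if "y \<in> carrier Q" for y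
    using R_right_total[OF that] R_carrier g by (auto simp: eq xi_closed)
  have "(\<lambda>y\<in>carrier Q. transfer d y) \<in> Lie_derivations K Q"
  proof (rule Q.Lie_derivationsI)
    fix y assume y: "y \<in> carrier Q"
    then obtain x where R: "R x y" using R_right_total by blast
    then have x: "x \<in> carrier G" using R_carrier by blast
    show "transfer d y \<in> carrier Q" using tg[OF y] by (rule gamma2_closed)
    show "transfer d (a \<odot>\<^bsub>Q\<^esub> y) = a \<odot>\<^bsub>Q\<^esub> transfer d y" if "a \<in> carrier K" for a
      using eq[OF R] eq[OF R_smult[OF that R]] that x g by (simp add: D xi_smult)
    fix y' assume "y' \<in> carrier Q"
    then obtain x' where R': "R x' y'" using R_right_total by blast
    then have x': "x' \<in> carrier G" using R_carrier by blast
    show "transfer d (y \<oplus>\<^bsub>Q\<^esub> y') = transfer d y \<oplus>\<^bsub>Q\<^esub> transfer d y'"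
      using eq[OF R] eq[OF R'] eq[OF R_add[OF R R']] x x' g by (simp add: D xi_add)
    have "transfer d (lie_sym Q y y') = \<xi> (lie_sym G (d x) x' \<oplus>\<^bsub>G\<^esub> lie_sym G x (d x'))"
      using eq[OF R_lie_sym[OF R R']] x x' by (simp add: D)
    also have "\<dots> = \<xi> (lie_sym G (d x) x') \<oplus>\<^bsub>Q\<^esub> \<xi> (lie_sym G x (d x'))"
      using x x' by (simp add: xi_add D G.lie_sym_in_gamma2)
    \<comment> \<open>By \<open>R_xi\<close> the value \<open>\<xi> (d x)\<close> is a partner of
      \<open>d x\<close>, so \<open>xi_lie_sym\<close> also applies to brackets with a derived
      argument.\<close>
    also have "\<dots> = lie_sym Q (\<xi> (d x)) y' \<oplus>\<^bsub>Q\<^esub> lie_sym Q y (\<xi> (d x'))"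
      using xi_lie_sym[OF R_xi[OF g[OF x]] R'] xi_lie_sym[OF R R_xi[OF g[OF x']]] by simp
    finally show "transfer d (lie_sym Q y y') =
        lie_sym Q (transfer d y) y' \<oplus>\<^bsub>Q\<^esub> lie_sym Q y (transfer d y')"
      by (simp add: eq[OF R] eq[OF R'])
  qed
  moreover have "(\<lambda>y\<in>carrier Q. transfer d y) = transfer d"
    by (auto simp: transfer_def)
  moreover have "transfer d z = \<zero>\<^bsub>Q\<^esub>" if z: "z \<in> Lie_center Q" for z
  proof -
    obtain x where R: "R x z" using R_right_total Lie_center_closed[OF z] by blast
    then have "d x = \<zero>\<^bsub>G\<^esub>" using R_center z Lie_ID_D(3)[OF d] by blast
    then show ?thesis using eq[OF R] xi_zero by simp
  qed
  ultimately show ?thesis using tg by (auto simp: Lie_ID_simps)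
qed

text \<open>Equality of transported derivations is tested on related pairs only; these reach all of
  \<open>carrier Q\<close>, and extensionality settles the rest.\<close>

lemma transfer_eqI:
  assumes "d \<in> carrier (Lie_ID K G)" "f \<in> extensional (carrier Q)"
    and "\<And>x y. R x y \<Longrightarrow> \<xi> (d x) = f y"
  shows "transfer d = f"
proof (rule extensionalityI[where A = "carrier Q"])
  show "transfer d \<in> extensional (carrier Q)" by (simp add: transfer_def)
  fix y assume "y \<in> carrier Q"
  then obtain x where "R x y" using R_right_total by blast
  then show "transfer d y = f y" using assms transfer_eq by simp
qed (rule assms)

section \<open>The inverse transport\<close>

text \<open>Makes every result of the locale available in the direction from \<open>Q\<close> to
  \<open>G\<close>.\<close>

lemma isoclinism_relation_swap:
  "Lie_isoclinism_relation K Q G R\<inverse>\<inverse> (inv_into (Lie_gamma2 K G) \<xi>)"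
proof -
  let ?g = "inv_into (Lie_gamma2 K G) \<xi>"
  have gl: "?g (\<xi> c) = c" if "c \<in> Lie_gamma2 K G" for c
    using xi_bij that by (rule bij_betw_inv_into_left)
  have ex: "\<exists>b \<in> Lie_gamma2 K G. c = \<xi> b" if "c \<in> Lie_gamma2 K Q" for c
    using xi_bij that by (auto simp: bij_betw_def)
  show ?thesis
  proof unfold_locales
    show "bij_betw ?g (Lie_gamma2 K Q) (Lie_gamma2 K G)" using xi_bij by (rule bij_betw_inv_into)
    fix c assume c: "c \<in> Lie_gamma2 K Q"
    then obtain b where b: "b \<in> Lie_gamma2 K G" "c = \<xi> b" using ex by blast
    show "?g (a \<odot>\<^bsub>Q\<^esub> c) = a \<odot>\<^bsub>G\<^esub> ?g c" if "a \<in> carrier K" for a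
      using gl[OF gamma2_smult[OF that b(1)]] b that by (simp add: gl xi_smult)
    fix c' assume "c' \<in> Lie_gamma2 K Q"
    then obtain b' where b': "b' \<in> Lie_gamma2 K G" "c' = \<xi> b'" using ex by blast
    show "?g (c \<oplus>\<^bsub>Q\<^esub> c') = ?g c \<oplus>\<^bsub>G\<^esub> ?g c'"
      using gl[OF gamma2_add[OF b(1) b'(1)]] b b' by (simp add: gl xi_add)
  next
    fix x y x' y' assume "R\<inverse>\<inverse> x y" "R\<inverse>\<inverse> x' y'"
    then have R: "R y x" "R y' x'" by auto
    then show "?g (lie_sym Q x x') = lie_sym G y y'"
      using gl[OF G.lie_sym_in_gamma2[of y y']] R_carrier xi_lie_sym[OF R] by auto
  qed (auto simp: R_carrier R_left_total R_right_total R_add R_smult R_lie_sym R_center)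
qed

lemma transfer_inverse:
  assumes d: "d \<in> carrier (Lie_ID K G)"
  shows "Lie_isoclinism_relation.transfer G R\<inverse>\<inverse> (inv_into (Lie_gamma2 K G) \<xi>) (transfer d) = d"
proof -
  interpret S: Lie_isoclinism_relation K Q G "R\<inverse>\<inverse>" "inv_into (Lie_gamma2 K G) \<xi>"
    by (rule isoclinism_relation_swap)
  show ?thesis
  proof (rule S.transfer_eqI[OF transfer_closed[OF d]])
    show "d \<in> extensional (carrier G)" using G.Lie_derivationsD(5)[OF Lie_ID_D(1)[OF d]] .
    fix y x assume "R\<inverse>\<inverse> y x"
    then have R: "R x y" by simp
    then show "inv_into (Lie_gamma2 K G) \<xi> (transfer d y) = d x"
      using bij_betw_inv_into_left[OF xi_bij Lie_ID_D(2)[OF d]] R_carrier transfer_eq[OF d R] by auto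
  qed
qed

lemma bij_betw_transfer: "bij_betw transfer (carrier (Lie_ID K G)) (carrier (Lie_ID K Q))"
proof -
  let ?g = "inv_into (Lie_gamma2 K G) \<xi>"
  interpret S: Lie_isoclinism_relation K Q G "R\<inverse>\<inverse>" ?g
    by (rule isoclinism_relation_swap)
  \<comment> \<open>The swapped form of \<open>transfer_inverse\<close> would involve the twice
    inverted \<open>\<xi>\<close>, which is only known to agree with \<open>\<xi>\<close> on
    \<open>Lie_gamma2 K G\<close>; hence a direct computation.\<close>
  have "transfer (S.transfer e) = e" if e: "e \<in> carrier (Lie_ID K Q)" for e
  proof (rule transfer_eqI[OF S.transfer_closed[OF e]])
    show "e \<in> extensional (carrier Q)" using Q.Lie_derivationsD(5)[OF S.Lie_ID_D(1)[OF e]] .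
    fix x y assume R: "R x y"
    then have "S.transfer e x = ?g (e y)" using S.transfer_eq[OF e] by simp
    then show "\<xi> (S.transfer e x) = e y"
      using bij_betw_inv_into_right[OF xi_bij S.Lie_ID_D(2)[OF e]] R_carrier[OF R] by simp
  qed
  then show ?thesis
    by (intro bij_betw_byWitness[where f' = S.transfer])
      (auto simp: transfer_inverse transfer_closed S.transfer_closed)
qed

section \<open>Compatibility with the Lie algebra structure\<close>

lemma transfer_iso: "transfer \<in> algebra_iso K (Lie_ID K G) (Lie_ID K Q)"
proof -
  interpret I: lie_algebra K "Lie_ID K G" by (rule G.lie_algebra_Lie_ID)
  have add: "transfer (d \<oplus>\<^bsub>Lie_ID K G\<^esub> e) = transfer d \<oplus>\<^bsub>Lie_ID K Q\<^esub> transfer e"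
    if d: "d \<in> carrier (Lie_ID K G)" and e: "e \<in> carrier (Lie_ID K G)" for d e
  proof (rule transfer_eqI)
    fix x y assume R: "R x y"
    then show "\<xi> ((d \<oplus>\<^bsub>Lie_ID K G\<^esub> e) x) = (transfer d \<oplus>\<^bsub>Lie_ID K Q\<^esub> transfer e) y"
      using R_carrier[OF R] Lie_ID_D(2)[OF d] Lie_ID_D(2)[OF e]
      by (simp add: Lie_ID_simps transfer_eq[OF d R] transfer_eq[OF e R] xi_add)
  \<comment> \<open>\<open>transfer_eqI\<close> needs the sum to lie in \<open>Lie_ID\<close>;
    closure is unfolded to match the restricted function that the simplifier produces.\<close>
  qed (use d e in \<open>simp_all add: Lie_ID_simps(3) I.M.a_closed[unfolded Lie_ID_simps(3)]\<close>)
  have smult: "transfer (a \<odot>\<^bsub>Lie_ID K G\<^esub> d) = a \<odot>\<^bsub>Lie_ID K Q\<^esub> transfer d"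
    if d: "d \<in> carrier (Lie_ID K G)" and a: "a \<in> carrier K" for a d
  proof (rule transfer_eqI)
    fix x y assume R: "R x y"
    then show "\<xi> ((a \<odot>\<^bsub>Lie_ID K G\<^esub> d) x) = (a \<odot>\<^bsub>Lie_ID K Q\<^esub> transfer d) y"
      using R_carrier[OF R] Lie_ID_D(2)[OF d] a
      by (simp add: Lie_ID_simps transfer_eq[OF d R] xi_smult)
  qed (use a d in \<open>simp_all add: Lie_ID_simps(4) I.smult_closed[unfolded Lie_ID_simps(4)]\<close>)
  have bracket: "transfer (d \<otimes>\<^bsub>Lie_ID K G\<^esub> e) = transfer d \<otimes>\<^bsub>Lie_ID K Q\<^esub> transfer e"
    if d: "d \<in> carrier (Lie_ID K G)" and e: "e \<in> carrier (Lie_ID K G)" for d e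
  proof (rule transfer_eqI)
    fix x y assume R: "R x y"
    then have x: "x \<in> carrier G" "y \<in> carrier Q" using R_carrier by auto
    note gd = Lie_ID_D(2)[OF d] and ge = Lie_ID_D(2)[OF e]
    \<comment> \<open>By \<open>R_xi\<close>, \<open>transfer e y = \<xi> (e x)\<close> is a partner
      of \<open>e x\<close>, so composites transport to composites.\<close>
    have "transfer d (transfer e y) = \<xi> (d (e x))" "transfer e (transfer d y) = \<xi> (e (d x))"
      using transfer_eq[OF d R_xi[OF ge]] transfer_eq[OF e R_xi[OF gd]] x
      by (simp_all add: transfer_eq[OF d R] transfer_eq[OF e R])
    then show "\<xi> ((d \<otimes>\<^bsub>Lie_ID K G\<^esub> e) x) = (transfer d \<otimes>\<^bsub>Lie_ID K Q\<^esub> transfer e) y"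
      using x gd ge by (simp add: Lie_ID_simps a_minus_def xi_add xi_minus gamma2_minus gamma2_closed)
  qed (use d e in \<open>simp_all add: Lie_ID_simps(2) I.bracket_closed[unfolded Lie_ID_simps(2)]\<close>)
  show ?thesis
    using add smult bracket bij_betw_transfer transfer_closed
    by (auto simp: algebra_iso_def linear_maps_def)
qed

end

section \<open>From an isoclinism to the relation\<close>

text \<open>Linearity and multiplicativity of \<open>\<eta>\<close> give the closure properties, its
  bijectivity gives totality on both sides and the matching of the Lie-centers.\<close>

lemma Lie_isoclinism_imp_relation:
  fixes K :: "('k, 'r) ring_scheme" and G :: "('k, 'a, 'm) module_scheme"
    and Q :: "('k, 'b, 'n) module_scheme"
  assumes "leibniz_algebra K G" "leibniz_algebra K Q" and iso: "Lie_isoclinism K G Q \<eta> \<xi>"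
  shows "Lie_isoclinism_relation K G Q
    (\<lambda>x y. x \<in> carrier G \<and> y \<in> carrier Q \<and>
      \<eta> (Lie_center G +>\<^bsub>G\<^esub> x) = Lie_center Q +>\<^bsub>Q\<^esub> y) \<xi>"
proof -
  interpret G: leibniz_algebra K G by fact
  interpret Q: leibniz_algebra K Q by fact
  let ?p = "\<lambda>x. Lie_center G +>\<^bsub>G\<^esub> x" and ?q = "\<lambda>y. Lie_center Q +>\<^bsub>Q\<^esub> y"
  let ?G = "quotient_algebra G (Lie_center G)" and ?Q = "quotient_algebra Q (Lie_center Q)"
  interpret GZ: leibniz_algebra K ?G
    by (rule G.leibniz_algebra_quotient[OF G.two_sided_ideal_Lie_center])
  interpret QZ: leibniz_algebra K ?Q
    by (rule Q.leibniz_algebra_quotient[OF Q.two_sided_ideal_Lie_center])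
  note p = G.quotient_algebra_rcoset[OF G.two_sided_ideal_Lie_center]
  note q = Q.quotient_algebra_rcoset[OF Q.two_sided_ideal_Lie_center]
  have eta: "bij_betw \<eta> (carrier ?G) (carrier ?Q)"
    and eta_closed: "\<And>X. X \<in> carrier ?G \<Longrightarrow> \<eta> X \<in> carrier ?Q"
    and eta_add: "\<And>X Y. \<lbrakk>X \<in> carrier ?G; Y \<in> carrier ?G\<rbrakk> \<Longrightarrow> \<eta> (X \<oplus>\<^bsub>?G\<^esub> Y) = \<eta> X \<oplus>\<^bsub>?Q\<^esub> \<eta> Y"
    and eta_mult: "\<And>X Y. \<lbrakk>X \<in> carrier ?G; Y \<in> carrier ?G\<rbrakk> \<Longrightarrow> \<eta> (X \<otimes>\<^bsub>?G\<^esub> Y) = \<eta> X \<otimes>\<^bsub>?Q\<^esub> \<eta> Y"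
    and eta_smult: "\<And>a X. \<lbrakk>a \<in> carrier K; X \<in> carrier ?G\<rbrakk> \<Longrightarrow> \<eta> (a \<odot>\<^bsub>?G\<^esub> X) = a \<odot>\<^bsub>?Q\<^esub> \<eta> X"
    using iso by (auto simp: Lie_isoclinism_def algebra_iso_def linear_maps_def)
  have xi: "bij_betw \<xi> (Lie_gamma2 K G) (Lie_gamma2 K Q)"
    "\<And>c c'. \<lbrakk>c \<in> Lie_gamma2 K G; c' \<in> Lie_gamma2 K G\<rbrakk> \<Longrightarrow> \<xi> (c \<oplus>\<^bsub>G\<^esub> c') = \<xi> c \<oplus>\<^bsub>Q\<^esub> \<xi> c'"
    "\<And>a c. \<lbrakk>a \<in> carrier K; c \<in> Lie_gamma2 K G\<rbrakk> \<Longrightarrow> \<xi> (a \<odot>\<^bsub>G\<^esub> c) = a \<odot>\<^bsub>Q\<^esub> \<xi> c"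
    using iso by (auto simp: Lie_isoclinism_def algebra_iso_def linear_maps_def)
  have pc: "?p x \<in> carrier ?G" if "x \<in> carrier G" for x using that by (simp add: p(1))
  have add: "\<eta> (?p (x \<oplus>\<^bsub>G\<^esub> x')) = ?q (y \<oplus>\<^bsub>Q\<^esub> y')"
    and mult: "\<eta> (?p (x \<otimes>\<^bsub>G\<^esub> x')) = ?q (y \<otimes>\<^bsub>Q\<^esub> y')"
    if "x \<in> carrier G" "x' \<in> carrier G" "y \<in> carrier Q" "y' \<in> carrier Q"
      "\<eta> (?p x) = ?q y" "\<eta> (?p x') = ?q y'" for x x' y y'
    using that eta_add[OF pc pc, of x x'] eta_mult[OF pc pc, of x x'] by (simp_all add: p(2,3) q(2,3))
  have smult: "\<eta> (?p (a \<odot>\<^bsub>G\<^esub> x)) = ?q (a \<odot>\<^bsub>Q\<^esub> y)"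
    if "a \<in> carrier K" "x \<in> carrier G" "y \<in> carrier Q" "\<eta> (?p x) = ?q y" for a x y
    using that eta_smult[OF _ pc, of a x] by (simp add: p(4) q(4))
  have "\<eta> \<zero>\<^bsub>?G\<^esub> = \<zero>\<^bsub>?Q\<^esub>"
    using eta_smult[of "\<zero>\<^bsub>K\<^esub>" "\<zero>\<^bsub>?G\<^esub>"] eta_closed[of "\<zero>\<^bsub>?G\<^esub>"] by simp
  then have zero: "\<eta> (Lie_center G) = Lie_center Q" by (simp add: p(5) q(5))
  have center: "x \<in> Lie_center G \<longleftrightarrow> y \<in> Lie_center Q"
    if xy: "x \<in> carrier G" "y \<in> carrier Q" "\<eta> (?p x) = ?q y" for x y
  proof -
    \<comment> \<open>The Lie-center is the zero coset, so injectivity of \<open>\<eta>\<close>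
      detects membership in it.\<close>
    have "?p x = Lie_center G \<longleftrightarrow> \<eta> (?p x) = \<eta> (Lie_center G)"
      using bij_betw_imp_inj_on[OF eta] pc[OF xy(1)] GZ.M.zero_closed
      by (auto simp: p(5) dest: inj_onD)
    then show ?thesis using xy zero p(6) q(6) by simp
  qed
  show ?thesis
  proof unfold_locales
    fix x assume "x \<in> carrier G"
    then show "\<exists>y. x \<in> carrier G \<and> y \<in> carrier Q \<and> \<eta> (?p x) = ?q y"
      using eta_closed[OF pc] by (auto simp: q(1))
  next
    fix y assume y: "y \<in> carrier Q"
    then have "?q y \<in> \<eta> ` carrier ?G" using bij_betw_imp_surj_on[OF eta] by (simp add: q(1))
    then show "\<exists>x. x \<in> carrier G \<and> y \<in> carrier Q \<and> \<eta> (?p x) = ?q y"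
      using y by (auto simp: p(1))
  qed (use iso in \<open>auto simp: add mult smult center xi lie_sym_def Lie_isoclinism_def\<close>)
qed

theorem theorem5p4:
  fixes K :: "('k, 'r) ring_scheme"
    and G :: "('k, 'a, 'm) module_scheme"
    and Q :: "('k, 'b, 'n) module_scheme"
  assumes "field K"
    and "\<one>\<^bsub>K\<^esub> \<oplus>\<^bsub>K\<^esub> \<one>\<^bsub>K\<^esub> \<in> Units K"
    and "leibniz_algebra K G"
    and "leibniz_algebra K Q"
    and "Lie_isoclinic K G Q"
  shows "\<exists>\<phi>. \<phi> \<in> algebra_iso K (Lie_ID K G) (Lie_ID K Q)"
proof -
  obtain \<eta> \<xi> where "Lie_isoclinism K G Q \<eta> \<xi>" using assms(5) by (auto simp: Lie_isoclinic_def)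
  then show ?thesis
    using Lie_isoclinism_relation.transfer_iso[OF Lie_isoclinism_imp_relation[OF assms(3,4)]] by blast
qed

end
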